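(* Let $T>0$, $\Omega=(0,2\pi)$, and let $a\in C^1([0,2\pi])$ be real-valued. Let $\nu\in C(0,T]$ be a positive, strictly decreasing function with $\inf_{(0,T]}\nu>0$ and $\lim_{t\to0}\nu(t)=+\infty$, and put $\mu(t)=t/\nu(t)$. Let $s\in\mathbb{R}$. Then for every sufficiently small $\varepsilon>0$ there exist a positive integer $P$, constants $C(\varepsilon)>0$ and $c_1(\varepsilon)>0$, and (1) a sequence of coefficients $\{b_k^2(t)\}_k$ with $b_k>0$ such that, with constants $C_1,C_2,C_3>0$ independent of $k$, $C_1\le\inf_{(0,T]}b_k\le\sup_{(0,T]}b_k\le C_2$, $b_k\in C^2(0,T]$, and $\left|\frac{d^j}{dt^j}b_k(t)\right|\le C_3(\nu(t)/t)^j$ for all $t\in(0,T]$, $j=1,2$; (2) a sequence of initial data $\{(u_0^k,u_1^k)\}_k\subset\dot H^s(\Omega)\times\dot H^{s-1}(\Omega)$; such that the corresponding solutions $u^k$ on $[0,T]\times\Omega$ of $$\partial_t^2u^k+b_k^2(t)(i\partial_x+a(x))^2u^k=0,\quad u^k(0,x)=u_0^k(x),\quad \partial_tu^k(0,x)=u_1^k(x)$$ satisfy $$\sup_k\dot{\mathbb{E}}_1(u^k)(0)\le C(\varepsilon),$$ $$\sup_k\dot{\mathbb{E}}_1\Big(\exp\Big(-c_1(\varepsilon)\,\nu\big(\mu^{-1}(2^P/\sqrt{(i\partial_x+a(x))^2})\big)\Big)u^k\Big)(t)=+\infty\quad\text{for every }t\in(0,T].$$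
   Context: The operator $(i\partial_x+a(x))^2$ on $\Omega=(0,2\pi)$ with homogeneous Dirichlet boundary conditions is positive and self-adjoint with discrete spectrum $\Lambda=\{\lambda_k^2\}_k$, $0<\lambda_1^2\le\lambda_2^2\le\cdots\to\infty$, and eigenfunctions $\phi_\lambda$ ($\lambda^2\in\Lambda$, $\lambda>0$) forming an orthonormal basis of $L^2(\Omega)$; functions are regarded as extended $2\pi$-periodically in $x$. Generalized Fourier coefficients: $\hat f(\lambda)=\langle f,\phi_\lambda\rangle$, with $f=\sum_{\lambda^2\in\Lambda}\hat f(\lambda)\phi_\lambda$. The homogeneous Sobolev norms are $\|f\|_{\dot H^s(\Omega)}^2=\sum_{\lambda^2\in\Lambda}\lambda^{2s}|\hat f(\lambda)|^2$, $s\in\mathbb{R}$. The homogeneous energy is $$\dot{\mathbb{E}}_s(u)(t):=\|u(t,\cdot)\|_{\dot H^s(\Omega)}^2+\|\partial_tu(t,\cdot)\|_{\dot H^{s-1}(\Omega)}^2.$$ For a function $F$ on $(0,\infty)$, $F(\sqrt{(i\partial_x+a(x))^2})$ multiplies $\hat f(\lambda)$ by $F(\lambda)$. $\mu$ is strictly increasing on $(0,T]$ with inverse $\mu^{-1}$; for the finitely many $\lambda$ with $2^P/\lambda>\mu(T)$, $\mu^{-1}(2^P/\lambda)$ is taken to be $T$. Solutions are understood through the expansion: each coefficient satisfies $\partial_t^2\hat u^k(t,\lambda)+\lambda^2b_k^2(t)\hat u^k(t,\lambda)=0$ with initial values $\hat u_0^k(\lambda)$, $\hat u_1^k(\lambda)$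 at $t=0$. *)

theory Defs
  imports "HOL-Analysis.Analysis"
begin

abbreviation Omega :: "real set" where
  "Omega \<equiv> {0<..<2*pi}"

definition C1_on :: "real set \<Rightarrow> (real \<Rightarrow> real) \<Rightarrow> bool" where
  "C1_on S f \<longleftrightarrow>
     (\<exists>f'. (\<forall>x\<in>S. (f has_real_derivative f' x) (at x within S)) \<and> continuous_on S f')"

definition mag_deriv :: "(real \<Rightarrow> real) \<Rightarrow> (real \<Rightarrow> complex) \<Rightarrow> real \<Rightarrow> complex" where
  "mag_deriv a f x =
     \<i> * vector_derivative f (at x within {0..2*pi}) + complex_of_real (a x) * f x"

text \<open>
  \<open>f\<close> solves \<open>(i d/dx + a)\<^sup>2 f = lam\<^sup>2 f\<close> with \<open>f 0 = f (2 pi) = 0\<close>.  For \<open>a\<close> of class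
  \<open>C\<^sup>1\<close> the conditions force \<open>f\<close> to be \<open>C\<^sup>2\<close> up to the boundary; conversely every
  eigenfunction of the operator with domain \<open>H\<^sup>2 \<inter> H\<^sub>0\<^sup>1\<close> has such a representative.
\<close>

definition dirichlet_eigenfunction ::
    "(real \<Rightarrow> real) \<Rightarrow> real \<Rightarrow> (real \<Rightarrow> complex) \<Rightarrow> bool" where
  "dirichlet_eigenfunction a lam f \<longleftrightarrow>
     f differentiable_on {0..2*pi} \<and>
     mag_deriv a f differentiable_on {0..2*pi} \<and>
     (\<forall>x\<in>{0..2*pi}. mag_deriv a (mag_deriv a f) x = complex_of_real (lam\<^sup>2) * f x) \<and>
     f 0 = 0 \<and> f (2*pi) = 0"

definition L2 :: "(real \<Rightarrow> complex) set" where
  "L2 = {f. f \<in> borel_measurable (lebesgue_on Omega) \<and>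
            integrable (lebesgue_on Omega) (\<lambda>x. (cmod (f x))\<^sup>2)}"

definition ip :: "(real \<Rightarrow> complex) \<Rightarrow> (real \<Rightarrow> complex) \<Rightarrow> complex" where
  "ip f g = (LINT x|lebesgue_on Omega. f x * cnj (g x))"

text \<open>
  The eigenvalues are \<open>lam n\<^sup>2\<close>, listed with multiplicity; \<open>phi\<close> is a matching orthonormal
  basis of \<open>L\<^sup>2\<close>.  Such a system always exists: one may take \<open>lam n = (n + 1) / 2\<close> and
  \<open>phi n x = exp (i A(x)) sin ((n + 1) x / 2) / sqrt pi\<close>, where \<open>A\<close> is a primitive of \<open>a\<close>.
\<close>

definition dirichlet_eigenbasis ::
    "(real \<Rightarrow> real) \<Rightarrow> (nat \<Rightarrow> real) \<Rightarrow> (nat \<Rightarrow> real \<Rightarrow> complex) \<Rightarrow> bool" where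
  "dirichlet_eigenbasis a lam phi \<longleftrightarrow>
     (\<forall>n. 0 < lam n) \<and> incseq lam \<and> filterlim lam at_top sequentially \<and>
     (\<forall>n. phi n \<in> L2 \<and> dirichlet_eigenfunction a (lam n) (phi n)) \<and>
     (\<forall>m n. ip (phi m) (phi n) = (if m = n then 1 else 0)) \<and>
     (\<forall>f\<in>L2. (\<lambda>N. LINT x|lebesgue_on Omega. (cmod (f x - (\<Sum>n<N. ip f (phi n) * phi n x)))\<^sup>2)
                 \<longlonglongrightarrow> 0)"

text \<open>
  For negative \<open>s\<close> the elements of the Sobolev space of order \<open>s\<close> need not be functions, and
  solutions are only defined through their expansions.  A generalised function is therefore a
  conjugate-linear functional \<open>\<psi> \<mapsto> \<langle>f,\<psi>\<rangle>\<close> on the finite linear combinations of the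
  eigenfunctions (its values elsewhere play no role), and its coefficients are
  \<open>\<langle>f,phi n\<rangle> = f (phi n)\<close>.  An \<open>L\<^sup>2\<close> function \<open>f\<close> is identified with \<open>ip f\<close>.
\<close>

type_synonym gfun = "(real \<Rightarrow> complex) \<Rightarrow> complex"

definition gen_fun :: "(nat \<Rightarrow> real \<Rightarrow> complex) \<Rightarrow> gfun \<Rightarrow> bool" where
  "gen_fun phi f \<longleftrightarrow>
     (\<forall>N c. f (\<lambda>x. \<Sum>n<N. c n * phi n x) = (\<Sum>n<N. cnj (c n) * f (phi n)))"

definition coef :: "(nat \<Rightarrow> real \<Rightarrow> complex) \<Rightarrow> gfun \<Rightarrow> nat \<Rightarrow> complex" where
  "coef phi f n = f (phi n)"

definition Hdot_norm_sq ::
    "(nat \<Rightarrow> real) \<Rightarrow> (nat \<Rightarrow> real \<Rightarrow> complex) \<Rightarrow> real \<Rightarrow> gfun \<Rightarrow> ennreal" where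
  "Hdot_norm_sq lam phi s f = (\<Sum>n. ennreal (lam n powr (2 * s) * (cmod (coef phi f n))\<^sup>2))"

definition Hdot ::
    "(nat \<Rightarrow> real) \<Rightarrow> (nat \<Rightarrow> real \<Rightarrow> complex) \<Rightarrow> real \<Rightarrow> gfun set" where
  "Hdot lam phi s = {f. gen_fun phi f \<and> Hdot_norm_sq lam phi s f < \<infinity>}"

text \<open>\<open>F\<close> of the square root of the operator; see \<open>coef_spectral_mult\<close> below.\<close>

definition spectral_mult ::
    "(nat \<Rightarrow> real) \<Rightarrow> (nat \<Rightarrow> real \<Rightarrow> complex) \<Rightarrow> (real \<Rightarrow> real) \<Rightarrow> gfun \<Rightarrow> gfun" where
  "spectral_mult lam phi F f = (\<lambda>\<psi>. \<Sum>n | ip \<psi> (phi n) \<noteq> 0.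
     complex_of_real (F (lam n)) * coef phi f n * cnj (ip \<psi> (phi n)))"

definition time_deriv :: "real \<Rightarrow> (real \<Rightarrow> gfun) \<Rightarrow> real \<Rightarrow> gfun" where
  "time_deriv T u t = (\<lambda>\<psi>. vector_derivative (\<lambda>\<tau>. u \<tau> \<psi>) (at t within {0..T}))"

definition energy ::
    "real \<Rightarrow> (nat \<Rightarrow> real) \<Rightarrow> (nat \<Rightarrow> real \<Rightarrow> complex) \<Rightarrow> real \<Rightarrow> (real \<Rightarrow> gfun) \<Rightarrow> real \<Rightarrow> ennreal"
  where
  "energy T lam phi s u t =
     Hdot_norm_sq lam phi s (u t) + Hdot_norm_sq lam phi (s - 1) (time_deriv T u t)"

lemma coef_spectral_mult:
  assumes "\<And>m n. ip (phi m) (phi n) = (if m = n then 1 else 0)"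
  shows "coef phi (spectral_mult lam phi F f) m = complex_of_real (F (lam m)) * coef phi f m"
proof -
  have "{n. ip (phi m) (phi n) \<noteq> 0} = {m}"
    using assms by auto
  then show ?thesis
    using assms by (simp add: spectral_mult_def coef_def)
qed

lemma L2_integrable_mult:
  assumes "f \<in> L2" "g \<in> L2"
  shows "integrable (lebesgue_on Omega) (\<lambda>x. f x * cnj (g x))"
proof (rule Bochner_Integration.integrable_bound)
  show "integrable (lebesgue_on Omega) (\<lambda>x. (cmod (f x))\<^sup>2 + (cmod (g x))\<^sup>2)"
    using assms by (auto simp: L2_def)
  have [measurable]: "f \<in> borel_measurable (lebesgue_on Omega)"
      "g \<in> borel_measurable (lebesgue_on Omega)"
    using assms by (auto simp: L2_def)
  have [measurable]: "cnj \<in> borel_measurable borel"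
    by (intro borel_measurable_continuous_onI continuous_intros)
  show "(\<lambda>x. f x * cnj (g x)) \<in> borel_measurable (lebesgue_on Omega)"
    by measurable
  have "p * q \<le> p\<^sup>2 + q\<^sup>2" if "0 \<le> p" "0 \<le> q" for p q :: real
    using sum_squares_bound[of p q] mult_nonneg_nonneg[OF that] by linarith
  then show "AE x in lebesgue_on Omega.
      norm (f x * cnj (g x)) \<le> norm ((cmod (f x))\<^sup>2 + (cmod (g x))\<^sup>2)"
    by (auto simp: norm_mult intro!: AE_I2)
qed

lemma gen_fun_ip:
  assumes "f \<in> L2" "\<And>n. phi n \<in> L2"
  shows "gen_fun phi (ip f)"
  unfolding gen_fun_def ip_def
proof (intro allI)
  fix N and c :: "nat \<Rightarrow> complex"
  have "(LINT x|lebesgue_on Omega. f x * cnj (\<Sum>n<N. c n * phi n x)) =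
        (LINT x|lebesgue_on Omega. (\<Sum>n<N. cnj (c n) * (f x * cnj (phi n x))))"
    by (simp add: sum_distrib_left mult_ac)
  also have "\<dots> = (\<Sum>n<N. cnj (c n) * (LINT x|lebesgue_on Omega. f x * cnj (phi n x)))"
    using assms by (subst Bochner_Integration.integral_sum) (auto intro!: integrable_mult_right L2_integrable_mult)
  finally show "(LINT x|lebesgue_on Omega. f x * cnj (\<Sum>n<N. c n * phi n x)) =
      (\<Sum>n<N. cnj (c n) * (LINT x|lebesgue_on Omega. f x * cnj (phi n x)))" .
qed

definition mu :: "(real \<Rightarrow> real) \<Rightarrow> real \<Rightarrow> real" where
  "mu nu t = t / nu t"

definition mu_inv :: "real \<Rightarrow> (real \<Rightarrow> real) \<Rightarrow> real \<Rightarrow> real" where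
  "mu_inv T nu y = (if mu nu T < y then T else the_inv_into {0<..T} (mu nu) y)"

definition admissible_coeff ::
    "real \<Rightarrow> (real \<Rightarrow> real) \<Rightarrow> real \<Rightarrow> real \<Rightarrow> real \<Rightarrow> (real \<Rightarrow> real) \<Rightarrow> bool" where
  "admissible_coeff T nu C1 C2 C3 b \<longleftrightarrow>
     (\<forall>t\<in>{0<..T}. 0 < b t \<and> C1 \<le> b t \<and> b t \<le> C2) \<and>
     (\<exists>b1 b2.
        (\<forall>t\<in>{0<..T}. (b has_real_derivative b1 t) (at t within {0<..T}) \<and>
                      (b1 has_real_derivative b2 t) (at t within {0<..T})) \<and>
        continuous_on {0<..T} b2 \<and>
        (\<forall>t\<in>{0<..T}. \<bar>b1 t\<bar> \<le> C3 * (nu t / t) \<and> \<bar>b2 t\<bar> \<le> C3 * (nu t / t)\<^sup>2))"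

text \<open>
  The coefficient \<open>b\<close> is given only for positive times, so the equation is imposed on \<open>(0,T]\<close>,
  while the coefficients of the solution are \<open>C\<^sup>1\<close> on \<open>[0,T]\<close> and attain the data at \<open>0\<close>.
\<close>

definition wave_solution ::
    "real \<Rightarrow> (nat \<Rightarrow> real) \<Rightarrow> (nat \<Rightarrow> real \<Rightarrow> complex) \<Rightarrow> (real \<Rightarrow> real) \<Rightarrow> gfun \<Rightarrow> gfun \<Rightarrow>
     (real \<Rightarrow> gfun) \<Rightarrow> bool" where
  "wave_solution T lam phi b u0 u1 u \<longleftrightarrow>
     (\<forall>t\<in>{0..T}. gen_fun phi (u t)) \<and>
     (\<forall>n. \<exists>v. (\<forall>t\<in>{0..T}. ((\<lambda>\<tau>. coef phi (u \<tau>) n) has_vector_derivative v t) (at t within {0..T})) \<and>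
          continuous_on {0..T} v \<and>
          (\<forall>t\<in>{0<..T}. (v has_vector_derivative
              - complex_of_real ((lam n)\<^sup>2 * (b t)\<^sup>2) * coef phi (u t) n) (at t within {0..T})) \<and>
          coef phi (u 0) n = coef phi u0 n \<and> v 0 = coef phi u1 n)"

end

theory Submission
  imports Defs
begin

text \<open>
  Parametric resonance, mode by mode. If \<open>p\<close> is any function and \<open>g' = p\<close>, then
  \<open>w = sin x exp (g x)\<close> solves \<open>w'' + \<alpha> w = 0\<close> with \<open>\<alpha> = 1 - 2 p cot x - p' - p\<^sup>2\<close>. For
  \<open>p = sin\<^sup>4 x / 12\<close> the function \<open>\<alpha> - 1\<close> vanishes to third order at the multiples of \<open>\<pi>\<close>, so
  \<open>p\<close> can be cut off at \<open>M \<pi>\<close> keeping \<open>\<alpha>\<close> twice continuously differentiable, while \<open>w\<close> has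
  gained the factor \<open>exp (M \<pi> / 32)\<close>. The \<open>k\<close>-th solution lives on the single mode \<open>\<lambda>\<^sub>k\<close> with
  \<open>b\<^sub>k\<^sup>2 t = \<alpha> (\<lambda>\<^sub>k t)\<close>, cut off at the last multiple of \<open>\<pi> / \<lambda>\<^sub>k\<close> before the time \<open>r\<^sub>k\<close> given by
  \<open>\<mu> r\<^sub>k = 2 / \<lambda>\<^sub>k\<close>. As \<open>\<nu> t / t\<close> decreases, \<open>\<lambda>\<^sub>k \<le> 2 \<nu> t / t\<close> up to \<open>r\<^sub>k\<close>, which makes the
  coefficients admissible, and the energy grows like \<open>exp (\<lambda>\<^sub>k r\<^sub>k / 16) = exp (\<nu> r\<^sub>k / 8)\<close>. The
  weight \<open>exp (- \<nu> r\<^sub>k / 32)\<close>, squared, only takes away half of this exponent. Since \<open>r\<^sub>k\<close>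
  tends to \<open>0\<close>, the growth happens before any prescribed time.
\<close>

section \<open>Cutting off the sine at a multiple of pi\<close>

text \<open>The one-sided derivatives at \<open>p\<close> agree because \<open>f' p = 0\<close>. All
  differentiability across the cut comes from here.\<close>

lemma DERIV_freeze:
  fixes f :: "real \<Rightarrow> real"
  assumes "\<And>x. (f has_real_derivative f' x) (at x)" and "f' p = 0"
  shows "((\<lambda>x. if x \<le> p then f x else f p) has_real_derivative (if x \<le> p then f' x else 0)) (at x)"
proof -
  have "((\<lambda>x. if x \<in> {..p} then f x else f p) has_vector_derivative
      (if x \<in> {..p} then f' x else 0)) (at x within UNIV)"
  proof (rule has_vector_derivative_If_within_closures)
    have "closure {..p} = {..p}" "closure {p<..} = {p..}" by auto
    then show "(f has_vector_derivative f' x) (at x within {..p} \<union> (closure {..p} \<inter> closure {p<..}))"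
      using assms(1) by (simp add: has_real_derivative_iff_has_vector_derivative has_vector_derivative_at_within)
  qed (use assms in \<open>auto split: if_splits\<close>)
  then show ?thesis
    by (simp add: has_real_derivative_iff_has_vector_derivative)
qed

text \<open>The squared speed and its derivatives are polynomials in this function and the uncut
  \<open>sin x\<close> and \<open>cos x\<close>, so the product rule crosses \<open>M pi\<close>
  without case distinctions.\<close>

definition cut_sin :: "nat \<Rightarrow> real \<Rightarrow> real" where
  "cut_sin M x = (if x \<le> real M * pi then sin x else 0)"

lemma abs_cut_sin_le: "\<bar>cut_sin M x\<bar> \<le> 1"
  by (simp add: cut_sin_def abs_sin_le_one)

lemma sin_nat_pi: "sin (real M * pi) = 0"
  by (simp add: mult.commute)

lemma cut_sin_eq_0: "x \<ge> real M * pi \<Longrightarrow> cut_sin M x = 0"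
  by (cases "x = real M * pi") (auto simp: cut_sin_def sin_nat_pi)

text \<open>The cut sine itself has a corner at \<open>M pi\<close>. From exponent 2 on, the
  derivative of the power keeps a factor \<open>sin x\<close> and so vanishes there.\<close>

lemma DERIV_cut_sin_power:
  "((\<lambda>x. cut_sin M x ^ Suc (Suc n)) has_real_derivative
      real (Suc (Suc n)) * cut_sin M x ^ Suc n * cos x) (at x)"
proof -
  have "((\<lambda>x. sin x ^ Suc (Suc n)) has_real_derivative
      real (Suc (Suc n)) * sin x ^ Suc n * cos x) (at x)" for x :: real
    by (rule derivative_eq_intros refl)+ (simp add: algebra_simps)
  from DERIV_freeze[OF this, of "real M * pi" x] show ?thesis
    by (simp add: sin_nat_pi cut_sin_def if_distrib if_distribR cong: if_cong)
qed

lemma DERIV_cut_sin_power_ge_2 [derivative_intros]: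
  assumes "2 \<le> n" "d = real n * cut_sin M x ^ (n - 1) * cos x"
  shows "((\<lambda>x. cut_sin M x ^ n) has_real_derivative d) (at x)"
proof -
  obtain m where "n = Suc (Suc m)"
    using assms(1) by (metis Suc_le_D numeral_2_eq_2 Suc_le_mono)
  then show ?thesis
    using DERIV_cut_sin_power[of M m x] assms(2) by simp
qed

lemma continuous_cut_sin: "continuous_on A (cut_sin M)"
proof -
  have "continuous_on UNIV (\<lambda>x. sin (min x (real M * pi)))"
    by (intro continuous_intros)
  also have "(\<lambda>x. sin (min x (real M * pi))) = cut_sin M"
    by (auto simp: cut_sin_def min_def sin_nat_pi)
  finally show ?thesis
    using continuous_on_subset by blast
qed

text \<open>\<open>H\<close> is the primitive, zero at \<open>0\<close>, of
  \<open>sin x ^ 4 = 3/8 - cos (2 x) / 2 + cos (4 x) / 8\<close>. The mean value 3/8 is what makes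
  the solution grow.\<close>

definition cut_int :: "nat \<Rightarrow> real \<Rightarrow> real" where
  "cut_int M x = (let H = (\<lambda>x. 3 * x / 8 - sin (2 * x) / 4 + sin (4 * x) / 32)
     in if x \<le> real M * pi then H x else H (real M * pi))"

lemma DERIV_cut_int [derivative_intros]:
  "(cut_int M has_real_derivative cut_sin M x ^ 4) (at x)"
proof -
  have c4: "cos (4 * x) = 2 * (cos (2 * x))\<^sup>2 - 1" for x :: real
    using cos_double_cos[of "2 * x"] by simp
  have sq: "sin x ^ 4 = (1 - (cos x)\<^sup>2)\<^sup>2" for x :: real
    by (simp add: power4_eq_xxxx power2_eq_square sin_squared_eq[symmetric, unfolded power2_eq_square])
  have "((\<lambda>x. 3 * x / 8 - sin (2 * x) / 4 + sin (4 * x) / 32) has_real_derivative sin x ^ 4) (at x)"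
    for x :: real
    by (auto intro!: derivative_eq_intros)
      (unfold c4 sq cos_double_cos, simp add: field_simps power2_eq_square)
  from DERIV_freeze[OF this, of "real M * pi" x] show ?thesis
    by (simp add: cut_int_def[abs_def] Let_def cut_sin_def sin_nat_pi if_distrib if_distribR cong: if_cong)
qed

text \<open>At \<open>M pi\<close> the oscillating terms vanish and only the mean value contributes.
  Divided by 12 it gives the exponent \<open>M pi / 32\<close>.\<close>

lemma cut_int_late:
  assumes "x \<ge> real M * pi"
  shows "cut_int M x = 3 * (real M * pi) / 8"
proof -
  have "sin (2 * (real M * pi)) = 0" "sin (4 * (real M * pi)) = 0"
    using sin_nat_pi[of "2 * M"] sin_nat_pi[of "4 * M"] by (simp_all add: mult.assoc)
  then show ?thesis
    using assms by (cases "x = real M * pi") (auto simp: cut_int_def)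
qed

section \<open>The resonant speed and its derivatives\<close>

text \<open>With \<open>S = cut_sin M x\<close> and \<open>p = S ^ 4 / 12\<close>, the terms
  \<open>2 p cot x\<close> and \<open>p'\<close> are \<open>S ^ 3 cos x / 6\<close> and
  \<open>S ^ 3 cos x / 3\<close>. Differentiating the cube twice leaves a factor \<open>S\<close>,
  hence a continuous second derivative.\<close>

definition res_speed_sq :: "nat \<Rightarrow> real \<Rightarrow> real" where
  "res_speed_sq M x = 1 - cut_sin M x ^ 3 * cos x / 2 - cut_sin M x ^ 8 / 144"

definition res_speed_sq' :: "nat \<Rightarrow> real \<Rightarrow> real" where
  "res_speed_sq' M x =
     - (3 * (cut_sin M x ^ 2 * cos x ^ 2) - cut_sin M x ^ 3 * sin x) / 2 - cut_sin M x ^ 7 * cos x / 18"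

definition res_speed_sq'' :: "nat \<Rightarrow> real \<Rightarrow> real" where
  "res_speed_sq'' M x =
     - (6 * (cut_sin M x * cos x ^ 3) - 9 * (cut_sin M x ^ 2 * (cos x * sin x))
        - cut_sin M x ^ 3 * cos x) / 2
     - (7 * (cut_sin M x ^ 6 * cos x ^ 2) - cut_sin M x ^ 7 * sin x) / 18"

lemma DERIV_res_speed_sq: "(res_speed_sq M has_real_derivative res_speed_sq' M x) (at x)"
  unfolding res_speed_sq_def[abs_def] res_speed_sq'_def
  by (rule derivative_eq_intros refl | simp)+ (simp add: field_simps power2_eq_square)

lemma DERIV_res_speed_sq': "(res_speed_sq' M has_real_derivative res_speed_sq'' M x) (at x)"
  unfolding res_speed_sq'_def[abs_def] res_speed_sq''_def
  by (rule derivative_eq_intros refl | simp)+ (simp add: field_simps power2_eq_square power3_eq_cube)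

lemma abs_mult_le_1: "\<bar>x\<bar> \<le> 1 \<Longrightarrow> \<bar>y\<bar> \<le> 1 \<Longrightarrow> \<bar>x * y\<bar> \<le> (1::real)"
  by (simp add: abs_mult mult_le_one)

lemma abs_power_le_1: "\<bar>x\<bar> \<le> 1 \<Longrightarrow> \<bar>x ^ n\<bar> \<le> (1::real)"
  by (simp add: power_abs power_le_one)

lemmas trig_bounds = abs_mult_le_1 abs_power_le_1 abs_cut_sin_le abs_sin_le_one abs_cos_le_one

text \<open>The crude limits 1/4 and 4 are squares, which puts the speed itself between 1/2 and
  2.\<close>

lemma res_speed_sq_bounds: "1 / 4 \<le> res_speed_sq M x" "res_speed_sq M x \<le> 4"
proof -
  have "\<bar>cut_sin M x ^ 3 * cos x\<bar> \<le> 1" "\<bar>cut_sin M x ^ 8\<bar> \<le> 1"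
    by (intro trig_bounds)+
  then show "1 / 4 \<le> res_speed_sq M x" "res_speed_sq M x \<le> 4"
    unfolding res_speed_sq_def by linarith+
qed

lemma abs_res_speed_sq'_le: "\<bar>res_speed_sq' M x\<bar> \<le> 3"
proof -
  \<comment> \<open>Once the products are abstracted, the bound amounts to
    \<open>(3 + 1) / 2 + 1 / 18 \<le> 3\<close>.\<close>
  have *: "\<bar>- (3 * p - q) / 2 - r / 18\<bar> \<le> 3" if "\<bar>p\<bar> \<le> 1" "\<bar>q\<bar> \<le> 1" "\<bar>r\<bar> \<le> 1" for p q r :: real
    using that by (auto simp: abs_le_iff field_simps)
  show ?thesis
    unfolding res_speed_sq'_def by (intro * trig_bounds)
qed

lemma abs_res_speed_sq''_le: "\<bar>res_speed_sq'' M x\<bar> \<le> 9"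
proof -
  have *: "\<bar>- (6 * p - 9 * q - r) / 2 - (7 * v - w) / 18\<bar> \<le> 9"
    if "\<bar>p\<bar> \<le> 1" "\<bar>q\<bar> \<le> 1" "\<bar>r\<bar> \<le> 1" "\<bar>v\<bar> \<le> 1" "\<bar>w\<bar> \<le> 1" for p q r v w :: real
    using that by (auto simp: abs_le_iff field_simps)
  show ?thesis
    unfolding res_speed_sq''_def by (intro * trig_bounds)
qed

definition res_speed :: "nat \<Rightarrow> real \<Rightarrow> real" where
  "res_speed M x = sqrt (res_speed_sq M x)"

definition res_speed' :: "nat \<Rightarrow> real \<Rightarrow> real" where
  "res_speed' M x = res_speed_sq' M x / (2 * res_speed M x)"

text \<open>This is \<open>(b ^ 2)'' = 2 b b'' + 2 b' ^ 2\<close> solved for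
  \<open>b''\<close>.\<close>

definition res_speed'' :: "nat \<Rightarrow> real \<Rightarrow> real" where
  "res_speed'' M x = (res_speed_sq'' M x - 2 * (res_speed' M x)\<^sup>2) / (2 * res_speed M x)"

lemma res_speed_bounds: "1 / 2 \<le> res_speed M x" "res_speed M x \<le> 2"
proof -
  show "1 / 2 \<le> res_speed M x"
    unfolding res_speed_def
    by (rule real_le_rsqrt) (use res_speed_sq_bounds[of M x] in \<open>simp add: power2_eq_square\<close>)
  show "res_speed M x \<le> 2"
    unfolding res_speed_def
    by (rule real_le_lsqrt) (use res_speed_sq_bounds[of M x] in auto)
qed

lemma res_speed_pos: "0 < res_speed M x"
  using res_speed_bounds[of M x] by linarith

lemma res_speed_power2: "(res_speed M x)\<^sup>2 = res_speed_sq M x"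
  using res_speed_sq_bounds[of M x] by (simp add: res_speed_def)

lemma DERIV_res_speed: "(res_speed M has_real_derivative res_speed' M x) (at x)"
proof -
  have "res_speed_sq M x > 0"
    using res_speed_sq_bounds[of M x] by linarith
  then show ?thesis
    unfolding res_speed_def[abs_def] res_speed'_def
    by (auto intro!: derivative_eq_intros DERIV_res_speed_sq simp: field_simps)
qed

lemma DERIV_res_speed': "(res_speed' M has_real_derivative res_speed'' M x) (at x)"
  unfolding res_speed'_def[abs_def] res_speed''_def
  using res_speed_pos[of M x]
  by (auto intro!: derivative_eq_intros DERIV_res_speed_sq' DERIV_res_speed
      simp: field_simps power2_eq_square res_speed'_def)

lemma abs_res_speed'_le: "\<bar>res_speed' M x\<bar> \<le> 3"
proof -
  have "\<bar>res_speed' M x\<bar> = \<bar>res_speed_sq' M x\<bar> / (2 * res_speed M x)"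
    using res_speed_pos[of M x] by (simp add: res_speed'_def abs_mult)
  also have "\<dots> \<le> 3 / 1"
    using res_speed_bounds[of M x] abs_res_speed_sq'_le by (intro frac_le) auto
  finally show ?thesis by simp
qed

text \<open>The numerator is at most \<open>9 + 2 * 3 ^ 2 = 27\<close>, and the denominator is at
  least 1.\<close>

lemma abs_res_speed''_le: "\<bar>res_speed'' M x\<bar> \<le> 27"
proof -
  have "(res_speed' M x)\<^sup>2 \<le> 3\<^sup>2"
    by (rule power2_le_iff_abs_le[THEN iffD2]) (auto intro: abs_res_speed'_le)
  then have "\<bar>res_speed_sq'' M x - 2 * (res_speed' M x)\<^sup>2\<bar> \<le> 27"
    using abs_res_speed_sq''_le[of M x] zero_le_power2[of "res_speed' M x"] unfolding abs_le_iff
    by (simp, linarith)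
  moreover have "\<bar>res_speed'' M x\<bar> = \<bar>res_speed_sq'' M x - 2 * (res_speed' M x)\<^sup>2\<bar> / (2 * res_speed M x)"
    using res_speed_pos[of M x] by (simp add: res_speed''_def abs_mult)
  moreover have "\<dots> \<le> 27 / 1"
    using res_speed_bounds[of M x] calculation(1) by (intro frac_le) auto
  ultimately show ?thesis by simp
qed

lemma res_speed_derivs_late:
  assumes "x \<ge> real M * pi"
  shows "res_speed' M x = 0" "res_speed'' M x = 0"
  using cut_sin_eq_0[OF assms]
  by (simp_all add: res_speed'_def res_speed''_def res_speed_sq'_def res_speed_sq''_def)

lemma continuous_res_speed'': "continuous_on A (res_speed'' M)"
proof -
  have *: "continuous_on A (res_speed' M)" "continuous_on A (res_speed M)"
    using DERIV_res_speed' DERIV_res_speed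
    by (meson DERIV_isCont continuous_at_imp_continuous_on)+
  have "continuous_on A (res_speed_sq'' M)"
    unfolding res_speed_sq''_def[abs_def] by (intro continuous_intros continuous_cut_sin) auto
  then show ?thesis
    unfolding res_speed''_def[abs_def]
    using res_speed_pos[of M] by (intro continuous_intros *) (auto simp: less_imp_neq[symmetric])
qed

text \<open>Each time derivative costs a factor \<open>l\<close>, which is at most
  \<open>2 nu t / t\<close> up to \<open>\<tau>\<close>. Later the argument lies beyond the cut and
  the derivatives vanish. The constant is \<open>108 = 27 * 2 ^ 2\<close>, which also covers the
  first-order \<open>3 * 2\<close>.\<close>

lemma admissible_res_speed:
  assumes "0 < l" "0 < \<tau>" and nu: "\<And>t. 0 < t \<Longrightarrow> t \<le> T \<Longrightarrow> 0 < nu t"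
    and bound: "\<And>t. 0 < t \<Longrightarrow> t \<le> T \<Longrightarrow> t \<le> \<tau> \<Longrightarrow> l \<le> 2 * (nu t / t)"
    and M: "real M * pi \<le> l * \<tau>"
  shows "admissible_coeff T nu (1/2) 2 108 (\<lambda>t. res_speed M (l * t))"
  unfolding admissible_coeff_def
proof (intro conjI exI ballI)
  fix t assume t: "t \<in> {0<..T}"
  show "0 < res_speed M (l * t)" "1/2 \<le> res_speed M (l * t)" "res_speed M (l * t) \<le> 2"
    by (fact res_speed_pos res_speed_bounds)+
  have lin: "((\<lambda>t. l * t) has_real_derivative l) (at t within {0<..T})"
    by (auto intro!: derivative_eq_intros)
  show "((\<lambda>t. res_speed M (l * t)) has_real_derivative res_speed' M (l * t) * l) (at t within {0<..T})"
    by (rule DERIV_chain2[OF DERIV_res_speed lin])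
  show "((\<lambda>t. res_speed' M (l * t) * l) has_real_derivative res_speed'' M (l * t) * l * l) (at t within {0<..T})"
    by (intro DERIV_cmult_right DERIV_chain2[OF DERIV_res_speed' lin])
  have "\<bar>res_speed' M (l * t) * l\<bar> \<le> 108 * (nu t / t) \<and>
      \<bar>res_speed'' M (l * t) * l * l\<bar> \<le> 108 * (nu t / t)\<^sup>2"
  proof (cases "t \<le> \<tau>")
    case True
    have l: "l \<le> 2 * (nu t / t)" using bound t True by auto
    have "\<bar>res_speed' M (l * t)\<bar> * l \<le> 3 * (2 * (nu t / t))"
      using l abs_res_speed'_le \<open>0 < l\<close> by (intro mult_mono) auto
    moreover have "\<bar>res_speed'' M (l * t)\<bar> * (l * l) \<le> 27 * ((2 * (nu t / t)) * (2 * (nu t / t)))"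
      using l abs_res_speed''_le \<open>0 < l\<close> by (intro mult_mono) auto
    moreover have "0 \<le> nu t / t" using nu t by (simp add: less_imp_le)
    ultimately show ?thesis
      using \<open>0 < l\<close> by (simp add: abs_mult power2_eq_square mult.assoc)
  next
    case False
    then have "real M * pi \<le> l * t"
      using \<open>0 < l\<close> by (intro order_trans[OF M] mult_left_mono) auto
    then show ?thesis
      using nu t by (simp add: res_speed_derivs_late less_imp_le)
  qed
  then show "\<bar>res_speed' M (l * t) * l\<bar> \<le> 108 * (nu t / t)"
      "\<bar>res_speed'' M (l * t) * l * l\<bar> \<le> 108 * (nu t / t)\<^sup>2" by auto
next
  have "continuous_on {0<..T} (res_speed'' M \<circ> (\<lambda>t. l * t))"
    by (intro continuous_on_compose continuous_intros continuous_res_speed'')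
  then show "continuous_on {0<..T} (\<lambda>t. res_speed'' M (l * t) * l * l)"
    unfolding o_def by (intro continuous_intros)
qed

section \<open>The explicit growing solution\<close>

definition res_sol :: "nat \<Rightarrow> real \<Rightarrow> real" where
  "res_sol M x = sin x * exp (cut_int M x / 12)"

definition res_sol' :: "nat \<Rightarrow> real \<Rightarrow> real" where
  "res_sol' M x = (cos x + cut_sin M x ^ 4 * sin x / 12) * exp (cut_int M x / 12)"

lemma DERIV_res_sol: "(res_sol M has_real_derivative res_sol' M x) (at x)"
  unfolding res_sol_def[abs_def] res_sol'_def
  by (rule derivative_eq_intros refl | simp)+ (simp add: field_simps)

lemma DERIV_res_sol':
  "(res_sol' M has_real_derivative - (res_speed M x)\<^sup>2 * res_sol M x) (at x)"
proof -
  let ?S = "cut_sin M x"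
  have "(res_sol' M has_real_derivative
      (- sin x + (4 * ?S ^ 3 * cos x * sin x + ?S ^ 4 * cos x) / 12
        + (cos x + ?S ^ 4 * sin x / 12) * ?S ^ 4 / 12) * exp (cut_int M x / 12)) (at x)"
    unfolding res_sol'_def[abs_def]
    by (rule derivative_eq_intros refl | simp)+ (simp add: field_simps)
  \<comment> \<open>If \<open>?S = 0\<close>, both sides are \<open>- sin x\<close>. Otherwise
    \<open>x\<close> lies before the cut, so \<open>?S = sin x\<close> and the identity is
    polynomial.\<close>
  moreover have "- sin x + (4 * ?S ^ 3 * cos x * sin x + ?S ^ 4 * cos x) / 12
        + (cos x + ?S ^ 4 * sin x / 12) * ?S ^ 4 / 12 = - res_speed_sq M x * sin x"
    by (cases "?S = 0")
      (auto simp: res_speed_sq_def cut_sin_def field_simps eval_nat_numeral split: if_splits)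
  ultimately show ?thesis
    by (simp add: res_sol_def res_speed_power2 mult.assoc)
qed

lemma cut_int_0: "cut_int M 0 = 0"
  by (simp add: cut_int_def)

lemma res_sol_0: "res_sol M 0 = 0" "res_sol' M 0 = 1"
  by (simp_all add: res_sol_def res_sol'_def cut_int_0)

text \<open>Beyond the cut the speed is 1: the motion is a free oscillation whose amplitude stays at
  \<open>exp (M pi / 32)\<close>.\<close>

lemma res_sol_energy_late:
  assumes "x \<ge> real M * pi"
  shows "(res_sol M x)\<^sup>2 + (res_sol' M x)\<^sup>2 = exp (real M * pi / 16)"
proof -
  have "(exp (real M * pi / 32))\<^sup>2 = exp (real M * pi / 16)"
    by (simp add: power2_eq_square flip: exp_add)
  then show ?thesis
    unfolding res_sol_def res_sol'_def cut_int_late[OF assms] cut_sin_eq_0[OF assms]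
    by (simp add: power_mult_distrib mult.commute[of pi] flip: distrib_right)
qed

section \<open>Uniqueness for the equation of a single mode\<close>

text \<open>The quantity \<open>(|d|\<^sup>2 + |e|\<^sup>2) exp (- (1 + K) t)\<close> does not increase.\<close>

lemma linear_ode_zero:
  fixes d e :: "real \<Rightarrow> 'a::real_inner" and q :: "real \<Rightarrow> real"
  assumes d: "\<And>t. t \<in> {0..T} \<Longrightarrow> (d has_vector_derivative e t) (at t within {0..T})"
    and e: "\<And>t. t \<in> {0<..T} \<Longrightarrow> (e has_vector_derivative - q t *\<^sub>R d t) (at t within {0..T})"
    and cont: "continuous_on {0..T} e"
    and q: "\<And>t. t \<in> {0<..T} \<Longrightarrow> \<bar>q t\<bar> \<le> K"
    and init: "d 0 = 0" "e 0 = 0"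
    and t: "t \<in> {0..T}"
  shows "d t = 0" "e t = 0"
proof -
  define E where "E = (\<lambda>t. (inner (d t) (d t) + inner (e t) (e t)) * exp (- (1 + K) * t))"
  have "E t \<le> E 0"
  proof (cases "t = 0")
    case False
    have "continuous_on {0..T} d"
      using d continuous_on_vector_derivative by blast
    then have "continuous_on {0..t} d" "continuous_on {0..t} e"
      using cont t by (auto elim!: continuous_on_subset)
    then have "continuous_on {0..t} E"
      unfolding E_def by (intro continuous_intros)
    \<comment> \<open>The sign is checked only at interior times, since the equation is not imposed
      at \<open>0\<close>; continuity of \<open>E\<close> carries the estimate down to
      \<open>0\<close>.\<close>
    moreover have "\<exists>y. DERIV E x :> y \<and> y \<le> 0" if x: "0 < x" "x < t" for x
    proof -
      have "at x within {0..T} = at x"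
        using x t by (intro at_within_interior) auto
      then have [derivative_intros]: "(d has_vector_derivative e x) (at x)"
          "(e has_vector_derivative - q x *\<^sub>R d x) (at x)"
        using d[of x] e[of x] x t by auto
      have ip: "((\<lambda>x. inner (f x) (f x)) has_real_derivative 2 * inner (f x) f') (at x)"
        if "(f has_vector_derivative f') (at x)" for f :: "real \<Rightarrow> 'a" and f'
        using that unfolding has_vector_derivative_def has_field_derivative_def
        by (auto intro!: derivative_eq_intros simp: inner_commute algebra_simps)
      let ?y = "(2 * inner (d x) (e x) + 2 * inner (e x) (- q x *\<^sub>R d x)
          - (1 + K) * (inner (d x) (d x) + inner (e x) (e x))) * exp (- (1 + K) * x)"
      have "DERIV E x :> ?y"
        unfolding E_def
        by (rule derivative_eq_intros refl ip | fact)+ (simp add: algebra_simps)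
      moreover have "?y \<le> 0"
      proof -
        have 1: "2 * \<bar>inner (d x) (e x)\<bar> \<le> inner (d x) (d x) + inner (e x) (e x)"
        proof -
          have "\<bar>inner (d x) (e x)\<bar> \<le> norm (d x) * norm (e x)"
            by (rule Cauchy_Schwarz_ineq2)
          then show ?thesis
            using sum_squares_bound[of "norm (d x)" "norm (e x)"]
            by (simp add: power2_norm_eq_inner)
        qed
        have 2: "\<bar>1 - q x\<bar> \<le> 1 + K"
          using q[of x] x t by auto
        have "2 * inner (d x) (e x) + 2 * inner (e x) (- q x *\<^sub>R d x)
            = (1 - q x) * (2 * inner (d x) (e x))"
          by (simp add: inner_commute algebra_simps)
        also have "\<dots> \<le> \<bar>1 - q x\<bar> * (2 * \<bar>inner (d x) (e x)\<bar>)"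
          by (metis abs_ge_self abs_mult abs_numeral)
        also have "\<dots> \<le> (1 + K) * (inner (d x) (d x) + inner (e x) (e x))"
          using 1 2 by (intro mult_mono) auto
        finally show ?thesis
          by (simp add: mult_nonpos_nonneg)
      qed
      ultimately show ?thesis by blast
    qed
    ultimately show ?thesis
      using False t by (intro DERIV_nonpos_imp_decreasing_open[of 0 t]) auto
  qed simp
  then have "inner (d t) (d t) + inner (e t) (e t) \<le> 0"
    by (simp add: E_def init mult_le_0_iff)
  then show "d t = 0" "e t = 0"
    using inner_ge_zero[of "d t"] inner_ge_zero[of "e t"]
    unfolding inner_eq_zero_iff[of "d t", symmetric] inner_eq_zero_iff[of "e t", symmetric]
    by linarith+
qed

section \<open>The function \<open>mu\<close> and its inverse\<close>

lemma mu_strict_mono: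
  assumes "\<forall>t\<in>{0<..T}. nu t > 0" "strict_antimono_on {0<..T} nu"
  shows "strict_mono_on {0<..T} (mu nu)"
proof (rule strict_mono_onI)
  fix x y assume xy: "x \<in> {0<..T}" "y \<in> {0<..T}" "x < y"
  have "nu y < nu x"
    using monotone_onD[OF assms(2) xy] by simp
  then show "mu nu x < mu nu y"
    unfolding mu_def using xy assms(1) by (intro frac_less) auto
qed

lemma mu_surj:
  assumes "0 < T" "continuous_on {0<..T} nu" "\<forall>t\<in>{0<..T}. nu t > 0"
    and "strict_antimono_on {0<..T} nu" and y: "0 < y" "y \<le> mu nu T"
  shows "\<exists>t\<in>{0<..T}. mu nu t = y"
proof -
  have T: "nu T > 0" using assms by auto
  \<comment> \<open>A left end point for the intermediate value theorem: \<open>nu t0 > nu T\<close>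
    gives \<open>mu nu t0 < t0 / nu T < y\<close>. Halving makes the inequalities strict.\<close>
  define t0 where "t0 = min T (y * nu T) / 2"
  have "0 < y * nu T" using T y by simp
  then have t0: "0 < t0" "t0 < T" "t0 < y * nu T"
    unfolding t0_def using \<open>0 < T\<close> by linarith+
  have "nu T < nu t0"
    using monotone_onD[OF assms(4), of t0 T] t0 \<open>0 < T\<close> by simp
  then have "mu nu t0 < t0 / nu T"
    unfolding mu_def using t0 T by (intro divide_strict_left_mono) auto
  also have "\<dots> < y"
    using t0 T by (simp add: field_simps)
  finally have "mu nu t0 \<le> y" by simp
  moreover have "continuous_on {t0..T} (mu nu)"
    unfolding mu_def[abs_def]
  proof (intro continuous_intros continuous_on_subset[OF assms(2)] ballI)
    show "nu t \<noteq> 0" if "t \<in> {t0..T}" for t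
      using assms(3)[rule_format, of t] t0 that by simp
  qed (use t0 in auto)
  ultimately obtain t where "t0 \<le> t" "t \<le> T" "mu nu t = y"
    using IVT'[of "mu nu" t0 y T] y(2) t0(2) by (meson less_imp_le)
  then show ?thesis using t0 by auto
qed

lemma mu_mu_inv:
  assumes "0 < T" "continuous_on {0<..T} nu" "\<forall>t\<in>{0<..T}. nu t > 0"
    and "strict_antimono_on {0<..T} nu" and y: "0 < y" "y \<le> mu nu T"
  shows "mu_inv T nu y \<in> {0<..T}" "mu nu (mu_inv T nu y) = y"
proof -
  have "inj_on (mu nu) {0<..T}"
    by (intro strict_mono_on_imp_inj_on mu_strict_mono assms)
  moreover have "y \<in> mu nu ` {0<..T}"
    using mu_surj[OF assms] by auto
  ultimately show "mu_inv T nu y \<in> {0<..T}" "mu nu (mu_inv T nu y) = y"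
    using y by (simp_all add: mu_inv_def f_the_inv_into_f the_inv_into_into not_less[symmetric]
        del: greaterThanAtMost_iff)
qed

lemma mu_inv_in:
  assumes "0 < T" "continuous_on {0<..T} nu" "\<forall>t\<in>{0<..T}. nu t > 0"
    and "strict_antimono_on {0<..T} nu" and "0 < y"
  shows "mu_inv T nu y \<in> {0<..T}"
proof (cases "mu nu T < y")
  case True
  then show ?thesis using \<open>0 < T\<close> by (simp add: mu_inv_def)
next
  case False
  then show ?thesis using mu_mu_inv(1)[OF assms] by simp
qed

text \<open>The default value \<open>T\<close> is taken only when \<open>mu nu T < y\<close>, so
  this half of the inverse property survives for all positive \<open>y\<close>. Admissibility for
  every \<open>k\<close> rests on it.\<close>

lemma mu_mu_inv_le:
  assumes "0 < T" "continuous_on {0<..T} nu" "\<forall>t\<in>{0<..T}. nu t > 0"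
    and "strict_antimono_on {0<..T} nu" and "0 < y"
  shows "mu nu (mu_inv T nu y) \<le> y"
proof (cases "mu nu T < y")
  case True
  then show ?thesis by (simp add: mu_inv_def)
next
  case False
  then show ?thesis using mu_mu_inv(2)[OF assms] by simp
qed

text \<open>By monotonicity, \<open>mu nu (mu_inv T nu y) \<le> y < mu nu c\<close> forces
  \<open>mu_inv T nu y < c\<close>.\<close>

lemma mu_inv_tendsto_0:
  assumes "0 < T" "continuous_on {0<..T} nu" "\<forall>t\<in>{0<..T}. nu t > 0"
    and "strict_antimono_on {0<..T} nu"
  shows "filterlim (mu_inv T nu) (at_right 0) (at_right 0)"
  unfolding filterlim_at
proof
  have pos: "\<forall>\<^sub>F y in at_right (0::real). 0 < y"
    by (simp add: eventually_at_right_less)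
  then show "\<forall>\<^sub>F y in at_right 0. mu_inv T nu y \<in> {0<..} \<and> mu_inv T nu y \<noteq> 0"
    by eventually_elim (use mu_inv_in[OF assms] in force)
  show "(mu_inv T nu \<longlongrightarrow> 0) (at_right 0)"
  proof (rule order_tendstoI)
    fix a :: real assume "a < 0"
    show "\<forall>\<^sub>F y in at_right 0. a < mu_inv T nu y"
      using pos by eventually_elim (use mu_inv_in[OF assms] \<open>a < 0\<close> in force)
  next
    fix a :: real assume "0 < a"
    define c where "c = min a T"
    have c: "c \<in> {0<..T}" using \<open>0 < a\<close> \<open>0 < T\<close> by (auto simp: c_def)
    then have "0 < mu nu c" using assms(3) by (auto simp: mu_def)
    then have "\<forall>\<^sub>F y in at_right 0. y < mu nu c"
      by (intro eventually_at_rightI[of 0 "mu nu c"]) auto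
    with pos show "\<forall>\<^sub>F y in at_right 0. mu_inv T nu y < a"
    proof eventually_elim
      case (elim y)
      let ?t = "mu_inv T nu y"
      have t: "?t \<in> {0<..T}" "mu nu ?t \<le> y"
        using mu_inv_in[OF assms] mu_mu_inv_le[OF assms] elim by auto
      have "\<not> c \<le> ?t"
        using strict_mono_on_leD[OF mu_strict_mono[OF assms(3,4)] c t(1)] t(2) elim by linarith
      then show ?case by (simp add: c_def)
    qed
  qed
qed

section \<open>Norms and energies of a single excited mode\<close>

lemma Hdot_norm_sq_single:
  assumes "\<And>n. n \<noteq> k \<Longrightarrow> coef phi f n = 0"
  shows "Hdot_norm_sq lam phi s f = ennreal (lam k powr (2 * s) * (cmod (coef phi f k))\<^sup>2)"
  unfolding Hdot_norm_sq_def by (subst suminf_finite[of "{k}"]) (use assms in auto)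

text \<open>For the blow-up, one mode bounds the norm from below, so the remaining coefficients need
  no control.\<close>

lemma Hdot_norm_sq_ge:
  "ennreal (lam k powr (2 * s) * (cmod (coef phi f k))\<^sup>2) \<le> Hdot_norm_sq lam phi s f"
  unfolding Hdot_norm_sq_def
  by (rule order_trans[OF _ sum_le_suminf[OF summableI, of "{k}"]]) auto

lemma coef_time_deriv:
  assumes "0 < T" "t \<in> {0..T}"
    and "((\<lambda>\<tau>. coef phi (u \<tau>) n) has_vector_derivative v) (at t within {0..T})"
  shows "coef phi (time_deriv T u t) n = v"
  using vector_derivative_within_cbox[of 0 T t] assms by (simp add: coef_def time_deriv_def)

context
  fixes T s :: real and a nu :: "real \<Rightarrow> real"
    and lam :: "nat \<Rightarrow> real" and phi :: "nat \<Rightarrow> real \<Rightarrow> complex"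
    and b :: "real \<Rightarrow> real" and M k :: nat
  assumes T: "T > 0" and basis: "dirichlet_eigenbasis a lam phi"
    and b_def: "b = (\<lambda>t. res_speed M (lam k * t))"
begin

lemma lam_pos: "0 < lam n" and phi_L2: "phi n \<in> L2"
  and ip_phi: "ip (phi m) (phi n) = (if m = n then 1 else 0)"
  using basis by (auto simp: dirichlet_eigenbasis_def)

lemma coef_ip_phi: "coef phi (ip (phi m)) n = (if m = n then 1 else 0)"
  by (simp add: coef_def ip_phi)

lemma data_in_Hdot: "(\<lambda>\<psi>. 0) \<in> Hdot lam phi s" "ip (phi k) \<in> Hdot lam phi s"
  using gen_fun_ip[of "phi k" phi, OF phi_L2 phi_L2]
  by (simp_all add: Hdot_def gen_fun_def coef_ip_phi Hdot_norm_sq_single[of k] coef_def[of _ "\<lambda>_. 0"])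

text \<open>Time is rescaled by \<open>lam k\<close>; dividing the position by \<open>lam k\<close>
  keeps the initial velocity equal to 1.\<close>

lemma DERIV_scaled_res_sol:
  "((\<lambda>t. res_sol M (lam k * t) / lam k) has_real_derivative res_sol' M (lam k * t)) (at t within S)"
  "((\<lambda>t. res_sol' M (lam k * t)) has_real_derivative
      - ((lam k)\<^sup>2 * (b t)\<^sup>2) * (res_sol M (lam k * t) / lam k)) (at t within S)"
proof -
  have lin: "((\<lambda>t. lam k * t) has_real_derivative lam k) (at t within S)"
    by (auto intro!: derivative_eq_intros)
  show "((\<lambda>t. res_sol M (lam k * t) / lam k) has_real_derivative res_sol' M (lam k * t)) (at t within S)"
    using DERIV_cdivide[OF DERIV_chain2[OF DERIV_res_sol lin], where c = "lam k"] lam_pos[of k] by simp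
  show "((\<lambda>t. res_sol' M (lam k * t)) has_real_derivative
      - ((lam k)\<^sup>2 * (b t)\<^sup>2) * (res_sol M (lam k * t) / lam k)) (at t within S)"
    using DERIV_chain2[OF DERIV_res_sol' lin] lam_pos[of k]
    by (simp add: b_def power2_eq_square mult_ac)
qed

lemma continuous_scaled_res_sol': "continuous_on S (\<lambda>t. res_sol' M (lam k * t))"
  using DERIV_scaled_res_sol(2) by (rule DERIV_continuous_on)

lemma wave_solution_exists:
  "wave_solution T lam phi b (\<lambda>\<psi>. 0) (ip (phi k))
     (\<lambda>t \<psi>. complex_of_real (res_sol M (lam k * t) / lam k) * ip (phi k) \<psi>)"
  unfolding wave_solution_def
proof (intro conjI ballI allI exI)
  fix t show "gen_fun phi (\<lambda>\<psi>. complex_of_real (res_sol M (lam k * t) / lam k) * ip (phi k) \<psi>)"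
    using gen_fun_ip[of "phi k" phi, OF phi_L2 phi_L2] by (simp add: gen_fun_def sum_distrib_left sum_divide_distrib mult_ac)
next
  fix n t
  let ?c = "\<lambda>t. complex_of_real (res_sol M (lam k * t) / lam k) * coef phi (ip (phi k)) n"
  let ?v = "\<lambda>t. complex_of_real (res_sol' M (lam k * t)) * coef phi (ip (phi k)) n"
  have c: "coef phi (\<lambda>\<psi>. complex_of_real (res_sol M (lam k * t) / lam k) * ip (phi k) \<psi>) n = ?c t" for t
    by (simp add: coef_def)
  show "((\<lambda>\<tau>. coef phi (\<lambda>\<psi>. complex_of_real (res_sol M (lam k * \<tau>) / lam k) * ip (phi k) \<psi>) n)
      has_vector_derivative ?v t) (at t within {0..T})"
    unfolding c
    by (intro has_vector_derivative_mult_left has_vector_derivative_of_real DERIV_scaled_res_sol(1))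
  have "(?v has_vector_derivative
      complex_of_real (- ((lam k)\<^sup>2 * (b t)\<^sup>2) * (res_sol M (lam k * t) / lam k)) *
      coef phi (ip (phi k)) n) (at t within {0..T})"
    by (intro has_vector_derivative_mult_left has_vector_derivative_of_real DERIV_scaled_res_sol(2))
  then show "(?v has_vector_derivative - complex_of_real ((lam n)\<^sup>2 * (b t)\<^sup>2) *
      coef phi (\<lambda>\<psi>. complex_of_real (res_sol M (lam k * t) / lam k) * ip (phi k) \<psi>) n) (at t within {0..T})"
    unfolding c by (cases "n = k") (simp_all add: coef_ip_phi)
  show "continuous_on {0..T} ?v"
    by (intro continuous_intros continuous_scaled_res_sol')
  show "coef phi (\<lambda>\<psi>. complex_of_real (res_sol M (lam k * 0) / lam k) * ip (phi k) \<psi>) n = coef phi (\<lambda>\<psi>. 0) n"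
    by (simp add: coef_def res_sol_0)
  show "?v 0 = coef phi (ip (phi k)) n"
    by (simp add: res_sol_0)
qed

context
  fixes u
  assumes sol: "wave_solution T lam phi b (\<lambda>\<psi>. 0) (ip (phi k)) u"
begin

text \<open>The initial position is zero and the velocity is measured in order 0, where
  \<open>phi k\<close> has norm 1; hence the value is the same for all \<open>k\<close>.\<close>

lemma initial_energy: "energy T lam phi 1 u 0 = 1"
proof -
  have u0: "coef phi (u 0) n = 0" and u1: "coef phi (time_deriv T u 0) n = (if k = n then 1 else 0)" for n
  proof -
    obtain v where v: "((\<lambda>\<tau>. coef phi (u \<tau>) n) has_vector_derivative v 0) (at 0 within {0..T})"
        "coef phi (u 0) n = coef phi (\<lambda>\<psi>. 0) n" "v 0 = coef phi (ip (phi k)) n"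
      using sol T unfolding wave_solution_def by (metis atLeastAtMost_iff less_imp_le order_refl)
    show "coef phi (u 0) n = 0" using v(2) by (simp add: coef_def)
    show "coef phi (time_deriv T u 0) n = (if k = n then 1 else 0)"
      using coef_time_deriv[OF T _ v(1)] T v(3) by (simp add: coef_ip_phi)
  qed
  show ?thesis
    using lam_pos[of k] by (simp add: energy_def Hdot_norm_sq_single[of k] u0 u1)
qed

text \<open>The difference to the explicit solution solves the same linear equation with zero data,
  and its coefficient is bounded by \<open>4 (lam k) ^ 2\<close>; so \<open>linear_ode_zero\<close>
  applies to an arbitrary solution \<open>u\<close>.\<close>

lemma resonant_mode:
  assumes "t \<in> {0..T}"
  shows "coef phi (u t) k = complex_of_real (res_sol M (lam k * t) / lam k)"
    and "((\<lambda>\<tau>. coef phi (u \<tau>) k) has_vector_derivative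
        complex_of_real (res_sol' M (lam k * t))) (at t within {0..T})"
proof -
  obtain v where v: "\<And>t. t \<in> {0..T} \<Longrightarrow> ((\<lambda>\<tau>. coef phi (u \<tau>) k) has_vector_derivative v t) (at t within {0..T})"
      "continuous_on {0..T} v"
      "\<And>t. t \<in> {0<..T} \<Longrightarrow> (v has_vector_derivative
          - complex_of_real ((lam k)\<^sup>2 * (b t)\<^sup>2) * coef phi (u t) k) (at t within {0..T})"
      "coef phi (u 0) k = 0" "v 0 = 1"
    using sol unfolding wave_solution_def by (fastforce simp: coef_ip_phi coef_def[of _ "\<lambda>_. 0"])
  let ?d = "\<lambda>t. coef phi (u t) k - complex_of_real (res_sol M (lam k * t) / lam k)"
  let ?e = "\<lambda>t. v t - complex_of_real (res_sol' M (lam k * t))"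
  have d: "(?d has_vector_derivative ?e t) (at t within {0..T})" if "t \<in> {0..T}" for t
    by (intro has_vector_derivative_diff v(1) that has_vector_derivative_of_real DERIV_scaled_res_sol(1))
  have e: "(?e has_vector_derivative - ((lam k)\<^sup>2 * (b t)\<^sup>2) *\<^sub>R ?d t) (at t within {0..T})"
    if "t \<in> {0<..T}" for t
  proof -
    have "(?e has_vector_derivative - complex_of_real ((lam k)\<^sup>2 * (b t)\<^sup>2) * coef phi (u t) k
        - complex_of_real (- ((lam k)\<^sup>2 * (b t)\<^sup>2) * (res_sol M (lam k * t) / lam k))) (at t within {0..T})"
      by (intro has_vector_derivative_diff v(3) that has_vector_derivative_of_real DERIV_scaled_res_sol(2))
    then show ?thesis
      by (simp add: scaleR_conv_of_real algebra_simps)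
  qed
  have q: "\<bar>(lam k)\<^sup>2 * (b t)\<^sup>2\<bar> \<le> (lam k)\<^sup>2 * 4" for t
    using res_speed_sq_bounds[of M "lam k * t"]
    by (simp add: b_def res_speed_power2 abs_mult mult_left_mono)
  have cont: "continuous_on {0..T} ?e"
    by (intro continuous_intros v(2) continuous_scaled_res_sol')
  have "?d t = 0" "?e t = 0"
    by (rule linear_ode_zero[where d = ?d and e = ?e, OF d e cont q _ _ assms];
        simp add: v(4,5) res_sol_0)+
  then show "coef phi (u t) k = complex_of_real (res_sol M (lam k * t) / lam k)"
    "((\<lambda>\<tau>. coef phi (u \<tau>) k) has_vector_derivative
        complex_of_real (res_sol' M (lam k * t))) (at t within {0..T})"
    using v(1)[OF assms] by simp_all
qed

text \<open>The weight \<open>lam k ^ 2\<close> of the order 1 norm cancels the division by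
  \<open>lam k\<close>, and the multiplier acts on mode \<open>k\<close> as the scalar
  \<open>F (lam k)\<close>.\<close>

lemma weighted_energy_late:
  assumes "t \<in> {0..T}" and late: "real M * pi \<le> lam k * t"
  shows "ennreal ((F (lam k))\<^sup>2 * exp (real M * pi / 16))
    \<le> energy T lam phi 1 (\<lambda>\<tau>. spectral_mult lam phi F (u \<tau>)) t"
proof -
  let ?U = "\<lambda>\<tau>. spectral_mult lam phi F (u \<tau>)"
  have c: "coef phi (?U \<tau>) k = complex_of_real (F (lam k)) * coef phi (u \<tau>) k" for \<tau>
    using coef_spectral_mult ip_phi by blast
  have 0: "coef phi (?U t) k = complex_of_real (F (lam k)) * complex_of_real (res_sol M (lam k * t) / lam k)"
    unfolding c using resonant_mode(1)[OF assms(1)] by simp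
  have "((\<lambda>\<tau>. coef phi (?U \<tau>) k) has_vector_derivative
      complex_of_real (F (lam k)) * complex_of_real (res_sol' M (lam k * t))) (at t within {0..T})"
    unfolding c by (intro has_vector_derivative_mult_right resonant_mode(2) assms)
  then have 1: "coef phi (time_deriv T ?U t) k = complex_of_real (F (lam k)) * complex_of_real (res_sol' M (lam k * t))"
    by (rule coef_time_deriv[OF T assms(1)])
  have "(F (lam k))\<^sup>2 * exp (real M * pi / 16)
      = lam k powr (2 * 1) * (cmod (coef phi (?U t) k))\<^sup>2
        + lam k powr (2 * (1 - 1)) * (cmod (coef phi (time_deriv T ?U t) k))\<^sup>2"
    using lam_pos[of k] unfolding 0 1 res_sol_energy_late[OF late, symmetric]
    by (simp add: norm_mult norm_divide power_mult_distrib power_divide powr_numeral algebra_simps)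
  then have "ennreal ((F (lam k))\<^sup>2 * exp (real M * pi / 16))
      = ennreal (lam k powr (2 * 1) * (cmod (coef phi (?U t) k))\<^sup>2)
        + ennreal (lam k powr (2 * (1 - 1)) * (cmod (coef phi (time_deriv T ?U t) k))\<^sup>2)"
    by (simp add: ennreal_plus)
  also have "\<dots> \<le> energy T lam phi 1 ?U t"
    unfolding energy_def by (rule add_mono[OF Hdot_norm_sq_ge Hdot_norm_sq_ge])
  finally show ?thesis .
qed

end

end

section \<open>Choice of the sequence and comparison of growth with the weight\<close>

theorem theorem4p6:
  fixes T s :: real and a nu :: "real \<Rightarrow> real"
    and lam :: "nat \<Rightarrow> real" and phi :: "nat \<Rightarrow> real \<Rightarrow> complex"
  assumes "T > 0"
    and "C1_on {0..2*pi} a"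
    and "dirichlet_eigenbasis a lam phi"
    and "continuous_on {0<..T} nu"
    and "\<forall>t\<in>{0<..T}. nu t > 0"
    and "strict_antimono_on {0<..T} nu"
    and "(INF t\<in>{0<..T}. nu t) > 0"
    and "filterlim nu at_top (at_right 0)"
  shows "\<forall>\<^sub>F \<epsilon> in at_right (0::real).
    \<exists>(P::nat) (C::real) (c1::real) (C1::real) (C2::real) (C3::real)
      (b :: nat \<Rightarrow> real \<Rightarrow> real) (u0 :: nat \<Rightarrow> gfun) (u1 :: nat \<Rightarrow> gfun).
      P > 0 \<and> C > 0 \<and> c1 > 0 \<and> C1 > 0 \<and> C2 > 0 \<and> C3 > 0 \<and>
      (\<forall>k. admissible_coeff T nu C1 C2 C3 (b k)) \<and>
      (\<forall>k. u0 k \<in> Hdot lam phi s \<and> u1 k \<in> Hdot lam phi (s - 1)) \<and>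
      (\<exists>u. \<forall>k. wave_solution T lam phi (b k) (u0 k) (u1 k) (u k)) \<and>
      (\<forall>u. (\<forall>k. wave_solution T lam phi (b k) (u0 k) (u1 k) (u k)) \<longrightarrow>
         (SUP k. energy T lam phi 1 (u k) 0) \<le> ennreal C \<and>
         (\<forall>t\<in>{0<..T}.
            (SUP k. energy T lam phi 1
               (\<lambda>\<tau>. spectral_mult lam phi
                  (\<lambda>\<xi>. exp (- c1 * nu (mu_inv T nu (2 ^ P / \<xi>)))) (u k \<tau>)) t) = \<infinity>))"
  proof -
  have nu_pos: "nu t > 0" if "0 < t" "t \<le> T" for t
    using assms(5) that by auto
  have lam: "0 < lam n" for n
    using assms(3) by (simp add: dirichlet_eigenbasis_def)
  have lam_lim: "filterlim lam at_top sequentially"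
    using assms(3) by (simp add: dirichlet_eigenbasis_def)
  define r where "r k = mu_inv T nu (2 / lam k)" for k
  \<comment> \<open>The number of whole half-periods of the sine that fit in before time
    \<open>r k\<close>.\<close>
  define M where "M k = nat \<lfloor>lam k * r k / pi\<rfloor>" for k
  define b where "b k = (\<lambda>t. res_speed (M k) (lam k * t))" for k
  have r: "r k \<in> {0<..T}" for k
    unfolding r_def using lam[of k] by (intro mu_inv_in assms) auto
  \<comment> \<open>Rounding down loses at most one half-period, which costs the later estimate no
    more than the factor \<open>exp (- pi / 16)\<close>.\<close>
  have M: "real (M k) * pi \<le> lam k * r k" "lam k * r k - pi \<le> real (M k) * pi" for k
  proof -
    have "0 \<le> lam k * r k / pi"
      using lam[of k] r[of k] by simp
    then have "real (M k) \<le> lam k * r k / pi" "lam k * r k / pi - 1 \<le> real (M k)"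
      unfolding M_def by linarith+
    then show "real (M k) * pi \<le> lam k * r k" "lam k * r k - pi \<le> real (M k) * pi"
      by (simp_all add: field_simps)
  qed
  have adm: "admissible_coeff T nu (1/2) 2 108 (b k)" for k
    unfolding b_def
  proof (rule admissible_res_speed[where \<tau> = "r k"])
    fix t assume t: "0 < t" "t \<le> T" "t \<le> r k"
    have nu_r: "nu (r k) > 0" and nu_t: "nu t > 0"
      using nu_pos r t by auto
    have "mu nu t \<le> mu nu (r k)"
      using strict_mono_on_leD[OF mu_strict_mono[OF assms(5,6)], of t "r k"] t r[of k] by simp
    also have "\<dots> \<le> 2 / lam k"
      unfolding r_def using lam[of k] by (intro mu_mu_inv_le assms) auto
    finally show "lam k \<le> 2 * (nu t / t)"
      using lam[of k] nu_t t by (simp add: mu_def field_simps)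
  qed (use lam r M nu_pos in auto)
  have "filterlim (\<lambda>k. 2 / lam k) (at_right 0) sequentially"
    using lam lam_lim unfolding filterlim_at
    by (auto intro!: real_tendsto_divide_at_top[OF tendsto_const] always_eventually less_imp_neq[symmetric])
  then have r_lim: "filterlim r (at_right 0) sequentially"
    unfolding r_def by (intro filterlim_compose[OF mu_inv_tendsto_0] assms)
  have blow_up: "(SUP k. energy T lam phi 1
               (\<lambda>\<tau>. spectral_mult lam phi
                  (\<lambda>\<xi>. exp (- (1/32) * nu (mu_inv T nu (2 ^ 1 / \<xi>)))) (u k \<tau>)) t) = \<infinity>"
    if sol: "\<forall>k. wave_solution T lam phi (b k) (\<lambda>\<psi>. 0) (ip (phi k)) (u k)" and t: "t \<in> {0<..T}" for u t
  proof -
    let ?F = "\<lambda>\<xi>. exp (- (1/32) * nu (mu_inv T nu (2 ^ 1 / \<xi>)))"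
    let ?E = "\<lambda>k. energy T lam phi 1 (\<lambda>\<tau>. spectral_mult lam phi ?F (u k \<tau>)) t"
    have ev: "\<forall>\<^sub>F k in sequentially. exp (nu (r k) / 16 - pi / 16) \<le> (?F (lam k))\<^sup>2 * exp (real (M k) * pi / 16)
        \<and> r k < t"
    proof -
      have "0 < mu nu T"
        using assms(1) nu_pos[of T] by (simp add: mu_def)
      \<comment> \<open>For large \<open>k\<close> the default value of the inverse is not taken, so
        \<open>mu nu (r k)\<close> equals \<open>2 / lam k\<close>.\<close>
      then have "\<forall>\<^sub>F k in sequentially. 2 / lam k < mu nu T"
        using real_tendsto_divide_at_top[OF tendsto_const lam_lim, of 2] order_tendstoD(2) by blast
      moreover have "\<forall>\<^sub>F k in sequentially. r k < t"
        using r_lim t unfolding filterlim_at by (auto dest!: order_tendstoD(2)[of _ 0 _ t])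
      ultimately show ?thesis
      proof eventually_elim
        case (elim k)
        have "mu nu (r k) = 2 / lam k"
          unfolding r_def using lam[of k] elim by (intro mu_mu_inv(2) assms) auto
        moreover have "nu (r k) > 0" using nu_pos r[of k] by auto
        ultimately have "lam k * r k = 2 * nu (r k)"
          using lam[of k] r[of k] by (simp add: mu_def field_simps)
        \<comment> \<open>Resonance gains at least \<open>nu (r k) / 8 - pi / 16\<close> in the
          exponent; the squared weight takes away \<open>nu (r k) / 16\<close>.\<close>
        with M(2)[of k] have "nu (r k) / 16 - pi / 16 \<le> 2 * (- (1/32) * nu (r k)) + real (M k) * pi / 16"
          by linarith
        then have "exp (nu (r k) / 16 - pi / 16) \<le> exp (2 * (- (1/32) * nu (r k)) + real (M k) * pi / 16)"
          by simp
        also have "\<dots> = (?F (lam k))\<^sup>2 * exp (real (M k) * pi / 16)"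
          unfolding exp_add exp_double r_def by simp
        finally show ?case using elim by simp
      qed
    qed
    have "filterlim (\<lambda>k. - pi / 16 + 1 / 16 * nu (r k)) at_top sequentially"
      by (intro filterlim_tendsto_add_at_top[OF tendsto_const]
          filterlim_tendsto_pos_mult_at_top[OF tendsto_const] filterlim_compose[OF assms(8) r_lim]) simp
    from filterlim_compose[OF exp_at_top this]
    have lim: "filterlim (\<lambda>k. exp (nu (r k) / 16 - pi / 16)) at_top sequentially"
      by simp
    have "ennreal R \<le> (SUP k. ?E k)" for R
    proof -
      \<comment> \<open>One index beating \<open>R\<close> suffices; \<open>r k < t\<close> ensures
        that \<open>t\<close> lies beyond the cut, where the full gain is present.\<close>
      obtain k where k: "R \<le> exp (nu (r k) / 16 - pi / 16)" "r k < t"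
        "exp (nu (r k) / 16 - pi / 16) \<le> (?F (lam k))\<^sup>2 * exp (real (M k) * pi / 16)"
        using eventually_happens'[OF _ eventually_conj[OF ev filterlim_at_top[THEN iffD1, OF lim, rule_format, of R]]]
          sequentially_bot by blast
      have late: "real (M k) * pi \<le> lam k * t"
        using k(2) lam[of k] by (intro order_trans[OF M(1)] mult_left_mono) auto
      have "ennreal R \<le> ennreal ((?F (lam k))\<^sup>2 * exp (real (M k) * pi / 16))"
        using k by (intro ennreal_leI) linarith
      also have "\<dots> \<le> ?E k"
        using sol t late by (intro weighted_energy_late[OF assms(1,3) b_def]) auto
      also have "\<dots> \<le> (SUP k. ?E k)"
        by (rule SUP_upper) simp
      finally show ?thesis .
    qed
    note ge = this
    show ?thesis
    proof (cases "SUP k. ?E k" rule: ennreal_cases)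
      case (real x)
      with ge[of "x + 1"] show ?thesis
        by (simp add: ennreal_le_iff)
    qed (simp add: infinity_ennreal_def)
  qed
  have ex: "\<exists>u. \<forall>k. wave_solution T lam phi (b k) (\<lambda>\<psi>. 0) (ip (phi k)) (u k)"
    by (intro exI allI, rule wave_solution_exists[OF assms(1,3) b_def])
  have init: "(SUP k. energy T lam phi 1 (u k) 0) \<le> ennreal 1"
    if "\<forall>k. wave_solution T lam phi (b k) (\<lambda>\<psi>. 0) (ip (phi k)) (u k)" for u
    by (intro SUP_least) (simp add: initial_energy[OF assms(1,3) b_def that[rule_format]])
  note data = data_in_Hdot[OF assms(1,3) b_def]
  \<comment> \<open>The same witnesses serve every \<open>\<epsilon>\<close>. \<open>P = 1\<close>
    matches the \<open>2 / lam k\<close> in \<open>r\<close>, and \<open>C = 1\<close> is the common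
    initial energy.\<close>
  show ?thesis
    by (rule always_eventually, rule allI, rule exI[of _ "1::nat"], rule exI[of _ "1::real"],
        rule exI[of _ "1/32::real"], rule exI[of _ "1/2::real"], rule exI[of _ "2::real"],
        rule exI[of _ "108::real"], rule exI[of _ b], rule exI[of _ "\<lambda>k \<psi>. 0"],
        rule exI[of _ "\<lambda>k. ip (phi k)"], intro conjI allI impI ballI)
      (rule adm ex data | rule init blow_up, assumption+ | simp)+
qed

end
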